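(* Let $D$ be a non-empty set, let $X_1,X_2,X_3$ be Banach spaces, and let $P:X_1\times X_2\to X_3$ be a bounded bilinear operator. Let $V\subseteq F(D,X_2)$ and $W\subseteq F(D,X_3)$ be BK-spaces. If $P$ does not $(V,W)$-vanish at any point, then $M_{B_P}(V,W)$, with its operator norm, is a BK-space.
   Context: All vector spaces are over $\mathbb K=\mathbb R$ or $\mathbb C$. $F(D,X)$ is the vector space of all functions $D\to X$. A normed space $U\subseteq F(D,X)$ (vector subspace with its own norm) has continuous evaluations if $u\mapsto u(a)$ is continuous from $U$ to $X$ for every $a\in D$; a BK-space is a complete such space. $B_P:F(D,X_1)\times F(D,X_2)\to F(D,X_3)$ is defined by $B_P(f,v)(a):=P(f(a),v(a))$, $a\in D$. $M_{B_P}(V,W):=\{f\in F(D,X_1):B_P(f,v)\in W\ \forall v\in V\}$, with operator norm $\|f\|_M:=\sup\{\|B_P(f,v)\|_W:\|v\|_V\le1\}$. $P$ does not $(V,W)$-vanish at any point means: for each $a\in D$ there exists $c_a\in(0,\infty)$ such that for each $f\in M_{B_P}(V,W)$ there exists $v_f\in V$ with $\|v_f\|_V\le1$ and $\|f(a)\|_{X_1}\le c_a\|P(f(a),v_f(a))\|_{X_3}$. *)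

theory Defs
  imports "HOL-Analysis.Analysis" "HOL-Library.Function_Algebras"
begin

text \<open>
  Scalars: the class \<^class>\<open>real_normed_field\<close> stands for ``the reals or the complex numbers''.
  Both are instances, and by the Gelfand--Mazur theorem every instance is isometrically isomorphic
  to one of the two.

  The domain \<open>D\<close> of the functions is a type, hence non-empty, and \<open>F(D,X)\<close> is the full function
  type \<open>'d \<Rightarrow> 'x\<close>, with the pointwise operations of \<^theory>\<open>HOL-Library.Function_Algebras\<close> and
  the scalar multiplication \<open>pointwise\<close>.
\<close>

definition pointwise :: "('k \<Rightarrow> 'x \<Rightarrow> 'x) \<Rightarrow> 'k \<Rightarrow> ('d \<Rightarrow> 'x) \<Rightarrow> 'd \<Rightarrow> 'x" where
  "pointwise scl c f = (\<lambda>a. scl c (f a))"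

lemma vector_space_pointwise:
  assumes "vector_space scl"
  shows "vector_space (pointwise scl)"
proof -
  interpret vector_space scl by fact
  show ?thesis
    by unfold_locales
      (simp_all add: pointwise_def fun_eq_iff scale_right_distrib scale_left_distrib)
qed

text \<open>
  A vector subspace \<open>U\<close> with its own norm \<open>N\<close>; the values of \<open>N\<close> outside \<open>U\<close> are irrelevant.
\<close>

locale normed_subspace = vector_space scl
  for scl :: "'k::real_normed_field \<Rightarrow> 'v::ab_group_add \<Rightarrow> 'v" +
  fixes U :: "'v set" and N :: "'v \<Rightarrow> real"
  assumes subspace_U: "subspace U"
    and norm_nonneg: "u \<in> U \<Longrightarrow> 0 \<le> N u"
    and norm_eq_0_iff: "u \<in> U \<Longrightarrow> N u = 0 \<longleftrightarrow> u = 0"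
    and norm_scale: "u \<in> U \<Longrightarrow> N (scl c u) = norm c * N u"
    and norm_triangle: "u \<in> U \<Longrightarrow> v \<in> U \<Longrightarrow> N (u + v) \<le> N u + N v"

text \<open>
  \<^locale>\<open>Metric_space\<close> asks for non-negativity and symmetry also outside the carrier; hence the
  cut-off.
\<close>

definition norm_dist :: "'v::ab_group_add set \<Rightarrow> ('v \<Rightarrow> real) \<Rightarrow> 'v \<Rightarrow> 'v \<Rightarrow> real" where
  "norm_dist U N u v = (if u \<in> U \<and> v \<in> U then N (u - v) else 0)"

lemma (in normed_subspace) norm_minus_commute:
  assumes "u \<in> U" "v \<in> U"
  shows "N (u - v) = N (v - u)"
proof -
  have "v - u \<in> U" using assms subspace_U by (simp add: subspace_diff)
  from norm_scale[OF this, of "-1"] show ?thesis by simp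
qed

sublocale normed_subspace \<subseteq> metric: Metric_space U "norm_dist U N"
proof
  show "0 \<le> norm_dist U N u v" for u v
    using norm_nonneg subspace_U by (simp add: norm_dist_def subspace_diff)
  show "norm_dist U N u v = norm_dist U N v u" for u v
    using norm_minus_commute by (simp add: norm_dist_def)
  show "(norm_dist U N u v = 0) = (u = v)" if "u \<in> U" "v \<in> U" for u v
    using that norm_eq_0_iff[of "u - v"] subspace_U by (simp add: norm_dist_def subspace_diff)
  show "norm_dist U N u w \<le> norm_dist U N u v + norm_dist U N v w"
    if "u \<in> U" "v \<in> U" "w \<in> U" for u v w
    using that norm_triangle[of "u - v" "v - w"] subspace_U
    by (simp add: norm_dist_def subspace_diff)
qed

text \<open>
  A Banach space over \<open>'k\<close> is a type of class \<^class>\<open>banach\<close> with a scalar multiplication by \<open>'k\<close>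
  for which \<^const>\<open>norm\<close> is a norm.  This scalar multiplication restricts to \<^const>\<open>scaleR\<close> on the
  reals, because an additive continuous map between real normed spaces is real-linear.
\<close>

abbreviation Banach_space ::
  "('k::real_normed_field \<Rightarrow> 'x::banach \<Rightarrow> 'x) \<Rightarrow> bool" where
  "Banach_space scl \<equiv> normed_subspace scl UNIV norm"

locale BK_space = normed_subspace "pointwise scl" U N
  for scl :: "'k::real_normed_field \<Rightarrow> 'x::real_normed_vector \<Rightarrow> 'x"
    and U :: "('d \<Rightarrow> 'x) set" and N :: "('d \<Rightarrow> 'x) \<Rightarrow> real" +
  assumes continuous_evaluation: "continuous_map metric.mtopology euclidean (\<lambda>u. u a)"
    and complete: "metric.mcomplete"

text \<open>Linearity in each variable is over \<open>'k\<close>, unlike in \<^const>\<open>bounded_bilinear\<close>.\<close>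

definition bounded_bilinear_over ::
  "('k::real_normed_field \<Rightarrow> 'x::real_normed_vector \<Rightarrow> 'x) \<Rightarrow>
   ('k \<Rightarrow> 'y::real_normed_vector \<Rightarrow> 'y) \<Rightarrow> ('k \<Rightarrow> 'z::real_normed_vector \<Rightarrow> 'z) \<Rightarrow>
   ('x \<Rightarrow> 'y \<Rightarrow> 'z) \<Rightarrow> bool" where
  "bounded_bilinear_over s1 s2 s3 P \<longleftrightarrow>
     (\<forall>y. Vector_Spaces.linear s1 s3 (\<lambda>x. P x y)) \<and>
     (\<forall>x. Vector_Spaces.linear s2 s3 (\<lambda>y. P x y)) \<and>
     (\<exists>K. \<forall>x y. norm (P x y) \<le> K * norm x * norm y)"

definition pointwise_op :: "('x \<Rightarrow> 'y \<Rightarrow> 'z) \<Rightarrow> ('d \<Rightarrow> 'x) \<Rightarrow> ('d \<Rightarrow> 'y) \<Rightarrow> 'd \<Rightarrow> 'z" where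
  "pointwise_op P f v = (\<lambda>a. P (f a) (v a))"

definition multipliers ::
  "('x \<Rightarrow> 'y \<Rightarrow> 'z) \<Rightarrow> ('d \<Rightarrow> 'y) set \<Rightarrow> ('d \<Rightarrow> 'z) set \<Rightarrow> ('d \<Rightarrow> 'x) set" where
  "multipliers P V W = {f. \<forall>v\<in>V. pointwise_op P f v \<in> W}"

text \<open>
  The operator norm is the supremum of a set of reals, so it is meaningful only together with
  \<open>multiplier_bounded\<close>, which says that this supremum is finite.
\<close>

definition multiplier_norm ::
  "('x \<Rightarrow> 'y \<Rightarrow> 'z) \<Rightarrow> ('d \<Rightarrow> 'y) set \<Rightarrow> (('d \<Rightarrow> 'y) \<Rightarrow> real) \<Rightarrow> (('d \<Rightarrow> 'z) \<Rightarrow> real) \<Rightarrow>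
   ('d \<Rightarrow> 'x) \<Rightarrow> real" where
  "multiplier_norm P V NV NW f = (SUP v\<in>{v \<in> V. NV v \<le> 1}. NW (pointwise_op P f v))"

definition multiplier_bounded ::
  "('x \<Rightarrow> 'y \<Rightarrow> 'z) \<Rightarrow> ('d \<Rightarrow> 'y) set \<Rightarrow> (('d \<Rightarrow> 'y) \<Rightarrow> real) \<Rightarrow> (('d \<Rightarrow> 'z) \<Rightarrow> real) \<Rightarrow>
   ('d \<Rightarrow> 'x) \<Rightarrow> bool" where
  "multiplier_bounded P V NV NW f \<longleftrightarrow>
     bdd_above ((\<lambda>v. NW (pointwise_op P f v)) ` {v \<in> V. NV v \<le> 1})"

definition nowhere_vanishing ::
  "('x::real_normed_vector \<Rightarrow> 'y \<Rightarrow> 'z::real_normed_vector) \<Rightarrow>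
   ('d \<Rightarrow> 'y) set \<Rightarrow> (('d \<Rightarrow> 'y) \<Rightarrow> real) \<Rightarrow> ('d \<Rightarrow> 'z) set \<Rightarrow> bool" where
  "nowhere_vanishing P V NV W \<longleftrightarrow>
     (\<forall>a. \<exists>c>0. \<forall>f\<in>multipliers P V W. \<exists>v\<in>V.
        NV v \<le> 1 \<and> norm (f a) \<le> c * norm (P (f a) (v a)))"

end

theory Submission
  imports Defs
begin

text \<open>
  Since evaluations on \<open>V\<close> and \<open>W\<close> are continuous, multiplication by a multiplier has closed
  graph, hence is bounded; so the operator norm is finite.  If \<open>P\<close> vanishes nowhere, the norm of
  \<open>f a\<close> is at most a constant times the operator norm of \<open>f\<close>.  Thus the operator norm is definite
  with continuous evaluations, and a Cauchy sequence of multipliers converges pointwise to some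
  \<open>f\<close>.  For each \<open>v\<close> in \<open>V\<close> the products with \<open>v\<close> converge in \<open>W\<close>, and evaluating identifies
  their limit as the product of \<open>f\<close> and \<open>v\<close>; so \<open>f\<close> is a multiplier and the limit in operator
  norm.
\<close>

section \<open>Norms, limits and Cauchy sequences in a normed subspace\<close>

lemma (in normed_subspace) scale_mem: "u \<in> U \<Longrightarrow> scl c u \<in> U"
  using subspace_U by (simp add: subspace_scale)

lemma (in normed_subspace) diff_mem: "u \<in> U \<Longrightarrow> v \<in> U \<Longrightarrow> u - v \<in> U"
  using subspace_U by (simp add: subspace_diff)

lemma (in normed_subspace) add_mem: "u \<in> U \<Longrightarrow> v \<in> U \<Longrightarrow> u + v \<in> U"
  using subspace_U by (simp add: subspace_add)

lemma (in normed_subspace) zero_mem: "0 \<in> U"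
  using subspace_U by (simp add: subspace_0)

lemma (in normed_subspace) norm_zero: "N 0 = 0"
  using norm_eq_0_iff zero_mem by blast

lemma (in normed_subspace) norm_scale_of_real:
  "u \<in> U \<Longrightarrow> N (scl (of_real t) u) = \<bar>t\<bar> * N u"
  by (simp add: norm_scale)

lemma (in normed_subspace) norm_diff_triangle:
  assumes "u \<in> U" "v \<in> U"
  shows "N (u - v) \<le> N u + N v"
proof -
  have "N (u + - v) \<le> N u + N (- v)"
    using assms diff_mem[OF zero_mem, of v] by (intro norm_triangle) auto
  moreover have "N (- v) = N v"
    using norm_minus_commute[OF zero_mem assms(2)] by simp
  ultimately show ?thesis by simp
qed

text \<open>Because \<open>norm_dist\<close> is cut off to 0 outside \<open>U\<close>, small
  distances alone do not place the limit in \<open>U\<close>; its membership has to be carried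
  along.\<close>

lemma (in normed_subspace) limitin_iff:
  assumes "\<And>n. x n \<in> U"
  shows "limitin metric.mtopology x l sequentially \<longleftrightarrow>
    l \<in> U \<and> (\<lambda>n. N (x n - l)) \<longlonglongrightarrow> 0"
  using assms by (auto simp: metric.limitin_metric_dist_null norm_dist_def cong: conj_cong)

text \<open>Closed balls are sequentially closed. The bound is asked for only eventually, since in
  the completeness proof it holds from some index on.\<close>

lemma (in normed_subspace) norm_limit_le:
  assumes "\<And>n. x n \<in> U" and lim: "limitin metric.mtopology x l sequentially"
    and le: "\<forall>\<^sub>F n in sequentially. N (x n) \<le> B"
  shows "N l \<le> B"
proof -
  have l: "l \<in> U" and t: "(\<lambda>n. N (x n - l)) \<longlonglongrightarrow> 0"
    using lim assms(1) by (auto simp: limitin_iff)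
  have "\<forall>\<^sub>F n in sequentially. N l \<le> N (x n - l) + B"
    using le
  proof eventually_elim
    case (elim n)
    have "N l = N (x n - (x n - l))" by simp
    also have "\<dots> \<le> N (x n) + N (x n - l)"
      by (intro norm_diff_triangle diff_mem assms(1) l)
    finally show ?case using elim by simp
  qed
  moreover have "(\<lambda>n. N (x n - l) + B) \<longlonglongrightarrow> 0 + B"
    by (intro tendsto_intros t)
  ultimately show ?thesis
    using tendsto_lowerbound[of _ "0 + B" sequentially "N l"] by simp
qed

lemma (in normed_subspace) norm_sum_telescope_le:
  assumes "\<And>n. x n \<in> U" and "\<And>n. N (x (Suc n) - x n) \<le> g n" and "m \<le> n"
  shows "N (x n - x m) \<le> sum g {m..<n}"
  using \<open>m \<le> n\<close>
proof (induction n rule: dec_induct)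
  case base
  then show ?case by (simp add: norm_zero)
next
  case (step n)
  have "N (x (Suc n) - x m) = N ((x (Suc n) - x n) + (x n - x m))" by simp
  also have "\<dots> \<le> N (x (Suc n) - x n) + N (x n - x m)"
    by (intro norm_triangle diff_mem assms(1))
  also have "\<dots> \<le> g n + sum g {m..<n}"
    using assms(2) step.IH by (intro add_mono)
  finally show ?case using step.hyps by (simp add: add.commute)
qed

lemma (in normed_subspace) MCauchy_iff:
  "metric.MCauchy x \<longleftrightarrow>
    range x \<subseteq> U \<and> (\<forall>e>0. \<exists>K. \<forall>n n'. K \<le> n \<longrightarrow> K \<le> n' \<longrightarrow> N (x n - x n') < e)"
  by (auto simp: metric.MCauchy_def norm_dist_def image_subset_iff)

text \<open>Telescoping bounds the distance of two terms by a block of the series \<open>g\<close>,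
  and such blocks are small far out. This makes the images of the partial sums in the closed graph
  theorem a Cauchy sequence.\<close>

lemma (in normed_subspace) MCauchy_of_summable:
  assumes x: "\<And>n. x n \<in> U" and g: "\<And>n. N (x (Suc n) - x n) \<le> g n" and sg: "summable g"
  shows "metric.MCauchy x"
  unfolding MCauchy_iff
proof (intro conjI allI impI)
  show "range x \<subseteq> U" using x by auto
next
  fix e :: real assume "e > 0"
  then obtain K where K: "\<And>m n. K \<le> m \<Longrightarrow> norm (sum g {m..<n}) < e"
    using sg unfolding summable_Cauchy by blast
  have *: "N (x n - x m) < e" if "K \<le> m" "m \<le> n" for m n
  proof -
    have "N (x n - x m) \<le> sum g {m..<n}"
      using norm_sum_telescope_le[of x g m n] x g that by blast
    also have "\<dots> < e" using K[of m n] that by simp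
    finally show ?thesis .
  qed
  show "\<exists>K. \<forall>n n'. K \<le> n \<longrightarrow> K \<le> n' \<longrightarrow> N (x n - x n') < e"
  proof (intro exI allI impI)
    fix n n' assume "K \<le> n" "K \<le> n'"
    then show "N (x n - x n') < e"
      using *[of n n'] *[of n' n] norm_minus_commute[OF x x, of n n']
      by (cases "n \<le> n'") auto
  qed
qed

lemma (in normed_subspace) continuous_map_of_bound:
  fixes \<phi> :: "'v \<Rightarrow> 'y::real_normed_vector"
  assumes diff: "\<And>u v. \<phi> (u - v) = \<phi> u - \<phi> v"
    and bound: "\<And>u. u \<in> U \<Longrightarrow> norm (\<phi> u) \<le> C * N u"
  shows "continuous_map metric.mtopology euclidean \<phi>"
  unfolding continuous_map_def metric.openin_mtopology
proof (intro conjI allI impI)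
  fix S :: "'y set" and u assume "openin euclidean S" and u: "u \<in> {x \<in> topspace metric.mtopology. \<phi> x \<in> S}"
  then obtain e where e: "e > 0" "ball (\<phi> u) e \<subseteq> S"
    by (auto simp: open_contains_ball)
  have uU: "u \<in> U" using u by simp
  \<comment> \<open>Nothing is assumed about the sign of \<open>C\<close>, and it may be 0; |C| + 1
    is a positive constant above it.\<close>
  define r where "r = e / (\<bar>C\<bar> + 1)"
  have r: "r > 0" using e by (simp add: r_def)
  have "\<phi> v \<in> S" if v: "v \<in> metric.mball u r" for v
  proof -
    have vU: "v \<in> U" and lt: "N (u - v) < r"
      using v uU by (auto simp: metric.in_mball norm_dist_def)
    have "dist (\<phi> u) (\<phi> v) = norm (\<phi> (u - v))" by (simp add: dist_norm diff)
    also have "\<dots> \<le> C * N (u - v)" by (intro bound diff_mem uU vU)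
    also have "\<dots> \<le> (\<bar>C\<bar> + 1) * N (u - v)"
      by (intro mult_right_mono norm_nonneg diff_mem uU vU) simp
    also have "\<dots> < (\<bar>C\<bar> + 1) * r" using lt by (intro mult_strict_left_mono) auto
    also have "\<dots> = e" by (simp add: r_def)
    finally show ?thesis using e by auto
  qed
  then show "\<exists>r>0. metric.mball u r \<subseteq> {x \<in> topspace metric.mtopology. \<phi> x \<in> S}"
    using r by (intro exI[of _ r]) (auto simp: metric.in_mball)
qed auto

section \<open>Evaluations on a BK-space\<close>

lemma (in BK_space) tendsto_evaluation:
  assumes "limitin metric.mtopology x l sequentially"
  shows "(\<lambda>n. x n a) \<longlonglongrightarrow> l a"
  using continuous_map_limit[OF continuous_evaluation assms, of a]
  by (simp add: o_def limitin_canonical_iff)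

text \<open>Continuity at 0 sends some ball into the unit ball, and homogeneity spreads the bound to
  all of \<open>U\<close>. \<open>BK_space\<close> relates \<open>scl\<close> only to
  \<open>N\<close>, so its compatibility with the norm of the target space is assumed here.\<close>

lemma (in BK_space) evaluation_bounded:
  assumes "\<And>c x. norm (scl c x) = norm c * norm x"
  obtains C where "C \<ge> 0" "\<And>u. u \<in> U \<Longrightarrow> norm (u a) \<le> C * N u"
proof -
  have "openin metric.mtopology {u \<in> topspace metric.mtopology. u a \<in> ball 0 1}"
    using continuous_evaluation[of a] by (rule openin_continuous_map_preimage) simp
  moreover have "0 \<in> {u \<in> topspace metric.mtopology. u a \<in> ball 0 1}"
    using zero_mem by simp
  ultimately obtain r where r: "r > 0"
    "metric.mball 0 r \<subseteq> {u \<in> topspace metric.mtopology. u a \<in> ball 0 1}"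
    unfolding metric.openin_mtopology by blast
  have "norm (u a) \<le> 2 / r * N u" if u: "u \<in> U" for u
  proof (cases "u = 0")
    case True
    then show ?thesis by (simp add: norm_zero)
  next
    case False
    then have pos: "N u > 0" using u norm_nonneg norm_eq_0_iff by (metis less_eq_real_def)
    \<comment> \<open>Scales \<open>u\<close> to norm r/2, strictly inside the open ball of radius
      \<open>r\<close>.\<close>
    define t where "t = r / (2 * N u)"
    have t: "t > 0" using r pos by (simp add: t_def)
    let ?v = "pointwise scl (of_real t) u"
    have "N ?v = t * N u" using norm_scale_of_real u t by simp
    also have "\<dots> = r / 2" using pos by (simp add: t_def)
    also have "\<dots> < r" using r by simp
    finally have "N (0 - ?v) < r"
      using norm_minus_commute[OF zero_mem scale_mem[OF u]] by simp
    then have "?v \<in> metric.mball 0 r"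
      using u by (auto simp: metric.in_mball norm_dist_def zero_mem scale_mem)
    then have "norm (?v a) < 1" using r(2) by auto
    then have "t * norm (u a) < 1" using assms t by (simp add: pointwise_def)
    then show ?thesis using t r pos by (simp add: t_def field_simps)
  qed
  then show thesis using r by (intro that[of "2 / r"]) auto
qed

section \<open>The closed graph theorem for normed subspaces\<close>

text \<open>
  Baire's theorem makes some sublevel set of \<open>NW \<circ> T\<close> dense in a ball, so every \<open>u\<close> is
  approximated by a suitably scaled difference of two elements of that level set.
\<close>
lemma closed_graph_approximation:
  assumes "normed_subspace sV V NV" and "normed_subspace sW W NW"
    and complV: "Metric_space.mcomplete V (norm_dist V NV)"
    and T: "\<And>v. v \<in> V \<Longrightarrow> T v \<in> W"
    and T_diff: "\<And>u v. u \<in> V \<Longrightarrow> v \<in> V \<Longrightarrow> T (u - v) = T u - T v"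
    and T_scale: "\<And>c v. v \<in> V \<Longrightarrow> T (sV c v) = sW c (T v)"
  shows "\<exists>C\<ge>0. \<forall>u\<in>V. \<exists>u'\<in>V. NV (u - u') \<le> NV u / 2 \<and> NW (T u') \<le> C * NV u"
proof -
  interpret V: normed_subspace sV V NV by fact
  interpret W: normed_subspace sW W NW by fact
  \<comment> \<open>\<open>T\<close> is not known to be continuous, so these sets need not be
    closed. Baire's theorem is applied to their closures and yields only density in a ball, hence
    approximation.\<close>
  define A where "A n = {v \<in> V. NW (T v) \<le> real n}" for n
  let ?clA = "\<lambda>n. V.metric.mtopology closure_of A n"
  \<comment> \<open>Otherwise the union of the closures would have empty interior, although it is
    all of \<open>V\<close>, which is open and contains 0.\<close>
  have "\<exists>n. V.metric.mtopology interior_of ?clA n \<noteq> {}"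
  proof (rule ccontr)
    assume "\<not> ?thesis"
    then have "V.metric.mtopology interior_of \<Union> (range ?clA) = {}"
      by (intro V.metric.metric_Baire_category_alt complV) auto
    moreover have "\<Union> (range ?clA) = V"
    proof
      show "V \<subseteq> \<Union> (range ?clA)"
      proof
        fix v assume v: "v \<in> V"
        obtain n where "NW (T v) \<le> real n" using real_arch_simple by blast
        then have "v \<in> A n" using v by (simp add: A_def)
        moreover have "A n \<subseteq> ?clA n" by (rule closure_of_subset) (auto simp: A_def)
        ultimately show "v \<in> \<Union> (range ?clA)" by auto
      qed
    qed (use closure_of_subset_topspace[of V.metric.mtopology] in auto)
    ultimately show False
      using V.zero_mem interior_of_topspace[of V.metric.mtopology] by auto
  qed
  then obtain n x0 r where "r > 0" and x0: "x0 \<in> V" and "V.metric.mball x0 r \<subseteq> ?clA n"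
    by (auto simp: V.metric.metric_interior_of)
  then have dense: "\<exists>a\<in>A n. NV (x - a) < \<delta>" if "x \<in> V" "NV (x0 - x) < r" "\<delta> > 0" for x \<delta>
  proof -
    have "x \<in> V.metric.mball x0 r"
      using that x0 by (simp add: V.metric.in_mball norm_dist_def)
    then have "x \<in> ?clA n" using \<open>V.metric.mball x0 r \<subseteq> ?clA n\<close> by auto
    then obtain a where "a \<in> A n" "a \<in> V.metric.mball x \<delta>"
      using \<open>\<delta> > 0\<close> by (auto simp: V.metric.metric_closure_of)
    then show ?thesis
      using that by (auto simp: V.metric.in_mball norm_dist_def)
  qed
  have "\<exists>u'\<in>V. NV (u - u') \<le> NV u / 2 \<and> NW (T u') \<le> 4 * real n / r * NV u" if u: "u \<in> V" for u
  proof (cases "u = 0")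
    case True
    have "T 0 = 0" using T_diff[OF V.zero_mem V.zero_mem] by simp
    then show ?thesis
      using True V.zero_mem by (intro bexI[of _ 0]) (auto simp: V.norm_zero W.norm_zero)
  next
    case False
    then have pos: "NV u > 0"
      using u V.norm_nonneg V.norm_eq_0_iff by (metis less_eq_real_def)
    define t where "t = r / (2 * NV u)"
    have t: "t > 0" using \<open>r > 0\<close> pos by (simp add: t_def)
    let ?tu = "sV (of_real t) u"
    have tu: "?tu \<in> V" "NV ?tu = r / 2"
      using u pos t by (auto simp: V.scale_mem V.norm_scale_of_real) (simp add: t_def)
    have "NV (x0 - (x0 + ?tu)) < r"
      using V.norm_minus_commute[OF V.zero_mem tu(1)] tu \<open>r > 0\<close> by simp
    \<comment> \<open>The two errors of r/8 sum to r/4, half the norm of \<open>?tu\<close>. Undoing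
      the scaling by \<open>t\<close> turns this into \<open>NV u / 2\<close>.\<close>
    then obtain a where a: "a \<in> A n" "NV (x0 + ?tu - a) < r / 8"
      using dense[of "x0 + ?tu" "r / 8"] V.add_mem[OF x0 tu(1)] \<open>r > 0\<close> by auto
    obtain b where b: "b \<in> A n" "NV (x0 - b) < r / 8"
      using dense[of x0 "r / 8"] x0 \<open>r > 0\<close> by (auto simp: V.norm_zero)
    have ab: "a \<in> V" "b \<in> V" "NW (T a) \<le> n" "NW (T b) \<le> n" using a b by (auto simp: A_def)
    define u' where "u' = sV (of_real (1 / t)) (a - b)"
    have u': "u' \<in> V" using ab by (simp add: u'_def V.scale_mem V.diff_mem)
    have "u - u' = sV (of_real (1 / t)) (?tu - (a - b))"
      using t by (simp add: u'_def V.scale_right_diff_distrib flip: of_real_mult)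
    then have "NV (u - u') = 1 / t * NV (?tu - (a - b))"
      using V.norm_scale_of_real[of "?tu - (a - b)" "1 / t"] tu ab t by (simp add: V.diff_mem)
    \<comment> \<open>The centre \<open>x0\<close> cancels: approximating both
      \<open>x0 + ?tu\<close> and \<open>x0\<close> by elements of \<open>A n\<close> approximates
      \<open>?tu\<close> by their difference.\<close>
    also have "?tu - (a - b) = (x0 + ?tu - a) - (x0 - b)" by simp
    also have "NV \<dots> \<le> NV (x0 + ?tu - a) + NV (x0 - b)"
      by (intro V.norm_diff_triangle V.diff_mem V.add_mem x0 tu ab)
    also have "\<dots> \<le> r / 4" using a b by simp
    finally have 1: "NV (u - u') \<le> NV u / 2"
      using t pos \<open>r > 0\<close> by (simp add: t_def field_simps)
    have "T u' = sW (of_real (1 / t)) (T a - T b)"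
      using ab by (simp add: u'_def T_scale T_diff V.diff_mem del: of_real_divide)
    then have "NW (T u') = 1 / t * NW (T a - T b)"
      using W.norm_scale_of_real[of "T a - T b" "1 / t"] ab t by (simp add: T W.diff_mem)
    also have "\<dots> \<le> 1 / t * (2 * real n)"
      using W.norm_diff_triangle[of "T a" "T b"] ab t by (intro mult_left_mono) (auto simp: T)
    also have "\<dots> = 4 * real n / r * NV u" by (simp add: t_def)
    finally show ?thesis using 1 u' by blast
  qed
  then show ?thesis using \<open>r > 0\<close> by (intro exI[of _ "4 * real n / r"]) auto
qed

text \<open>Iterating the approximation halves the residual each time, so the sums of the
  corrections converge to the given vector. Their images have geometrically decreasing increments
  and converge because \<open>W\<close> is complete; \<open>closed\<close> identifies the limit.
  Completeness of \<open>V\<close> enters through Baire's theorem.\<close>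

theorem closed_graph:
  assumes nV: "normed_subspace sV V NV" and nW: "normed_subspace sW W NW"
    and complV: "Metric_space.mcomplete V (norm_dist V NV)"
    and complW: "Metric_space.mcomplete W (norm_dist W NW)"
    and T: "\<And>v. v \<in> V \<Longrightarrow> T v \<in> W"
    and T_diff: "\<And>u v. u \<in> V \<Longrightarrow> v \<in> V \<Longrightarrow> T (u - v) = T u - T v"
    and T_scale: "\<And>c v. v \<in> V \<Longrightarrow> T (sV c v) = sW c (T v)"
    and closed: "\<And>x l m. \<lbrakk>limitin (Metric_space.mtopology V (norm_dist V NV)) x l sequentially;
      limitin (Metric_space.mtopology W (norm_dist W NW)) (\<lambda>n. T (x n)) m sequentially\<rbrakk> \<Longrightarrow> T l = m"
  shows "\<exists>C\<ge>0. \<forall>v\<in>V. NW (T v) \<le> C * NV v"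
proof -
  interpret V: normed_subspace sV V NV by fact
  interpret W: normed_subspace sW W NW by fact
  obtain C where C: "C \<ge> 0"
    and ex: "\<And>u. u \<in> V \<Longrightarrow> \<exists>u'\<in>V. NV (u - u') \<le> NV u / 2 \<and> NW (T u') \<le> C * NV u"
    using closed_graph_approximation[of sV V NV sW W NW T, OF nV nW complV T T_diff T_scale]
    by auto
  obtain h where h: "\<And>u. u \<in> V \<Longrightarrow> h u \<in> V" "\<And>u. u \<in> V \<Longrightarrow> NV (u - h u) \<le> NV u / 2"
      "\<And>u. u \<in> V \<Longrightarrow> NW (T (h u)) \<le> C * NV u"
  proof -
    from ex have "\<forall>u. \<exists>u'. u \<in> V \<longrightarrow> u' \<in> V \<and> NV (u - u') \<le> NV u / 2 \<and> NW (T u') \<le> C * NV u"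
      by blast
    then show thesis using that by metis
  qed
  have "NW (T u) \<le> 2 * C * NV u" if u: "u \<in> V" for u
  proof -
    \<comment> \<open>The residual after \<open>n\<close> corrections; the difference
      \<open>s n\<close> below is the sum of these corrections.\<close>
    define R where "R n = ((\<lambda>v. v - h v) ^^ n) u" for n
    have R_Suc: "R (Suc n) = R n - h (R n)" for n by (simp add: R_def)
    have R: "R n \<in> V" for n
      by (induction n) (simp_all add: R_Suc h V.diff_mem, simp add: R_def u)
    have R_le: "NV (R n) \<le> NV u * (1/2) ^ n" for n
    proof (induction n)
      case 0
      then show ?case by (simp add: R_def)
    next
      case (Suc n)
      then show ?case using h(2)[OF R, of n] by (simp add: R_Suc)
    qed
    define s where "s n = u - R n" for n
    have s: "s n \<in> V" for n using u R by (simp add: s_def V.diff_mem)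
    have "(\<lambda>n. NV (R n)) \<longlonglongrightarrow> 0"
    proof (rule tendsto_sandwich[of "\<lambda>_. 0"])
      show "(\<lambda>n. NV u * (1/2) ^ n) \<longlonglongrightarrow> 0"
        by (intro tendsto_mult_right_zero LIMSEQ_power_zero) simp
    qed (use R V.norm_nonneg R_le in auto)
    moreover have "NV (s n - u) = NV (R n)" for n
      using V.norm_minus_commute[OF s u] by (simp add: s_def)
    ultimately have lim: "limitin V.metric.mtopology s u sequentially"
      using s u by (simp add: V.limitin_iff)
    \<comment> \<open>Geometric majorant of the increments of \<open>T (s n)\<close>; its total is
      the bound claimed for \<open>T u\<close>.\<close>
    define g where "g n = C * NV u * (1/2) ^ n" for n
    have g: "summable g" "suminf g = 2 * C * NV u"
      unfolding g_def by (auto simp: suminf_mult suminf_geometric)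
    have Ts: "T (s n) \<in> W" for n using s T by blast
    have step: "NW (T (s (Suc n)) - T (s n)) \<le> g n" for n
    proof -
      have "T (s (Suc n)) - T (s n) = T (s (Suc n) - s n)" using s by (simp add: T_diff)
      also have "s (Suc n) - s n = h (R n)" by (simp add: s_def R_Suc)
      finally have "NW (T (s (Suc n)) - T (s n)) \<le> C * NV (R n)" using h(3) R by simp
      also have "\<dots> \<le> C * (NV u * (1/2) ^ n)" by (intro mult_left_mono R_le C)
      finally show ?thesis by (simp add: g_def)
    qed
    have "W.metric.MCauchy (\<lambda>n. T (s n))"
      using Ts step g by (intro W.MCauchy_of_summable)
    then obtain m where m: "limitin W.metric.mtopology (\<lambda>n. T (s n)) m sequentially"
      using complW by (auto simp: W.metric.mcomplete_def)
    have "NW (T (s n)) \<le> 2 * C * NV u" for n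
    proof -
      \<comment> \<open>Telescoping from index 0 therefore bounds \<open>T (s n)\<close> itself and
        not merely a difference.\<close>
      have "T (s 0) = 0" using T_diff[OF u u] by (simp add: s_def R_def)
      then have "NW (T (s n)) \<le> sum g {0..<n}"
        using W.norm_sum_telescope_le[of "\<lambda>n. T (s n)" g 0 n] Ts step by simp
      also have "\<dots> \<le> suminf g"
        using g V.norm_nonneg[OF u] C by (intro sum_le_suminf) (auto simp: g_def)
      finally show ?thesis using g by simp
    qed
    then have "NW m \<le> 2 * C * NV u"
      using W.norm_limit_le[OF Ts m] by simp
    then show ?thesis using closed[OF lim m] by simp
  qed
  then show ?thesis using C by (intro exI[of _ "2 * C"]) auto
qed

section \<open>The multiplier setting and the algebra of pointwise products\<close>

locale multiplier_spaces =
  X1: normed_subspace s1 UNIV norm +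
  X2: normed_subspace s2 UNIV norm +
  X3: normed_subspace s3 UNIV norm +
  V: BK_space s2 V NV +
  W: BK_space s3 W NW
  for s1 :: "'k::real_normed_field \<Rightarrow> 'x1::banach \<Rightarrow> 'x1::banach"
    and s2 :: "'k::real_normed_field \<Rightarrow> 'x2::banach \<Rightarrow> 'x2::banach"
    and s3 :: "'k::real_normed_field \<Rightarrow> 'x3::banach \<Rightarrow> 'x3::banach"
    and V :: "('d \<Rightarrow> 'x2::banach) set" and NV :: "('d \<Rightarrow> 'x2::banach) \<Rightarrow> real"
    and W :: "('d \<Rightarrow> 'x3::banach) set" and NW :: "('d \<Rightarrow> 'x3::banach) \<Rightarrow> real" +
  fixes P :: "'x1::banach \<Rightarrow> 'x2::banach \<Rightarrow> 'x3::banach"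
  assumes bilinear: "bounded_bilinear_over s1 s2 s3 P"
    and nonvanishing: "nowhere_vanishing P V NV W"
begin

abbreviation M where "M \<equiv> multipliers P V W"
abbreviation NM where "NM \<equiv> multiplier_norm P V NV NW"

lemma module_hom_left: "module_hom s1 s3 (\<lambda>x. P x y)"
  and module_hom_right: "module_hom s2 s3 (P x)"
  using bilinear by (auto simp: bounded_bilinear_over_def module_hom_iff_linear)

lemmas P_left = module_hom.add[OF module_hom_left] module_hom.diff[OF module_hom_left]
  module_hom.scale[OF module_hom_left] module_hom.zero[OF module_hom_left]

lemmas P_right = module_hom.diff[OF module_hom_right] module_hom.scale[OF module_hom_right]

text \<open>Separate continuity follows from bilinearity and the norm bound. The left version
  identifies limits in the completeness proof; the right version shows that multiplication has
  closed graph.\<close>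

lemma tendsto_P_left: "x \<longlonglongrightarrow> l \<Longrightarrow> (\<lambda>n. P (x n) y) \<longlonglongrightarrow> P l y"
  and tendsto_P_right: "z \<longlonglongrightarrow> m \<Longrightarrow> (\<lambda>n. P w (z n)) \<longlonglongrightarrow> P w m"
proof -
  obtain K where K: "\<And>x y. norm (P x y) \<le> K * norm x * norm y"
    using bilinear by (auto simp: bounded_bilinear_over_def)
  show "(\<lambda>n. P (x n) y) \<longlonglongrightarrow> P l y" if "x \<longlonglongrightarrow> l"
  proof (rule LIM_zero_cancel, rule Lim_null_comparison)
    show "\<forall>\<^sub>F n in sequentially. norm (P (x n) y - P l y) \<le> K * norm (x n - l) * norm y"
      using K[of "x _ - l" y] by (simp add: P_left)
    show "(\<lambda>n. K * norm (x n - l) * norm y) \<longlonglongrightarrow> 0"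
      using tendsto_norm_zero[OF LIM_zero[OF that]]
      by (intro tendsto_mult_left_zero tendsto_mult_right_zero)
  qed
  show "(\<lambda>n. P w (z n)) \<longlonglongrightarrow> P w m" if "z \<longlonglongrightarrow> m"
  proof (rule LIM_zero_cancel, rule Lim_null_comparison)
    show "\<forall>\<^sub>F n in sequentially. norm (P w (z n) - P w m) \<le> K * norm w * norm (z n - m)"
      using K[of w "z _ - m"] by (simp add: P_right)
    show "(\<lambda>n. K * norm w * norm (z n - m)) \<longlonglongrightarrow> 0"
      using tendsto_norm_zero[OF LIM_zero[OF that]] by (rule tendsto_mult_right_zero)
  qed
qed

lemma pointwise_op_left:
  "pointwise_op P (f + g) v = pointwise_op P f v + pointwise_op P g v"
  "pointwise_op P (f - g) v = pointwise_op P f v - pointwise_op P g v"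
  "pointwise_op P (pointwise s1 c f) v = pointwise s3 c (pointwise_op P f v)"
  "pointwise_op P 0 v = 0"
  by (simp_all add: pointwise_op_def pointwise_def fun_eq_iff P_left)

lemma pointwise_op_right:
  "pointwise_op P f (v - w) = pointwise_op P f v - pointwise_op P f w"
  "pointwise_op P f (pointwise s2 c v) = pointwise s3 c (pointwise_op P f v)"
  by (simp_all add: pointwise_op_def pointwise_def fun_eq_iff P_right)

section \<open>Multipliers as bounded operators and their operator norm\<close>

lemma pointwise_op_mem: "f \<in> M \<Longrightarrow> v \<in> V \<Longrightarrow> pointwise_op P f v \<in> W"
  by (simp add: multipliers_def)

text \<open>The graph is closed because convergence in \<open>V\<close> and in \<open>W\<close>
  implies pointwise convergence: at each point the two candidate values are limits of the same
  sequence.\<close>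

lemma multiplier_operator_bounded:
  assumes f: "f \<in> M"
  shows "\<exists>C\<ge>0. \<forall>v\<in>V. NW (pointwise_op P f v) \<le> C * NV v"
proof (rule closed_graph[of "pointwise s2" V NV "pointwise s3" W NW "pointwise_op P f"])
  fix x l m
  assume x: "limitin V.metric.mtopology x l sequentially"
    and m: "limitin W.metric.mtopology (\<lambda>n. pointwise_op P f (x n)) m sequentially"
  show "pointwise_op P f l = m"
  proof
    fix a
    have "(\<lambda>n. P (f a) (x n a)) \<longlonglongrightarrow> P (f a) (l a)"
      by (intro tendsto_P_right V.tendsto_evaluation x)
    moreover have "(\<lambda>n. P (f a) (x n a)) \<longlonglongrightarrow> m a"
      using W.tendsto_evaluation[OF m, of a] by (simp add: pointwise_op_def)
    ultimately have "P (f a) (l a) = m a" by (rule LIMSEQ_unique)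
    then show "pointwise_op P f l a = m a" by (simp add: pointwise_op_def)
  qed
next
  show "pointwise_op P f v \<in> W" if "v \<in> V" for v by (rule pointwise_op_mem[OF f that])
  show "pointwise_op P f (u - v) = pointwise_op P f u - pointwise_op P f v" for u v
    by (rule pointwise_op_right)
  show "pointwise_op P f (pointwise s2 c v) = pointwise s3 c (pointwise_op P f v)" for c v
    by (rule pointwise_op_right)
qed (fact V.normed_subspace_axioms W.normed_subspace_axioms V.complete W.complete)+

lemma multiplier_bounded:
  assumes "f \<in> M"
  shows "multiplier_bounded P V NV NW f"
proof -
  obtain C where C: "C \<ge> 0" "\<And>v. v \<in> V \<Longrightarrow> NW (pointwise_op P f v) \<le> C * NV v"
    using multiplier_operator_bounded[OF assms] by blast
  have "NW (pointwise_op P f v) \<le> C" if "v \<in> V" "NV v \<le> 1" for v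
    using C(2)[OF that(1)] mult_left_mono[OF that(2) C(1)] by simp
  then show ?thesis
    unfolding multiplier_bounded_def by (intro bdd_aboveI2[where M = C]) auto
qed

text \<open>A real \<open>SUP\<close> dominates its members once the set is bounded above; the
  closed graph theorem supplies this through \<open>multiplier_bounded\<close>.\<close>

lemma le_multiplier_norm:
  "f \<in> M \<Longrightarrow> v \<in> V \<Longrightarrow> NV v \<le> 1 \<Longrightarrow> NW (pointwise_op P f v) \<le> NM f"
  using multiplier_bounded unfolding multiplier_norm_def multiplier_bounded_def
  by (intro cSUP_upper) auto

lemma multiplier_norm_le:
  assumes "\<And>v. v \<in> V \<Longrightarrow> NV v \<le> 1 \<Longrightarrow> NW (pointwise_op P f v) \<le> B"
  shows "NM f \<le> B"
  unfolding multiplier_norm_def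
proof (rule cSUP_least)
  show "{v \<in> V. NV v \<le> 1} \<noteq> {}" using V.zero_mem V.norm_zero by force
qed (use assms in auto)

text \<open>Homogeneity: normalise \<open>v\<close> to norm 1 and scale back, treating
  \<open>v = 0\<close> separately.\<close>

lemma le_multiplier_norm_mult:
  assumes f: "f \<in> M" and v: "v \<in> V"
  shows "NW (pointwise_op P f v) \<le> NM f * NV v"
proof (cases "v = 0")
  case True
  have "pointwise_op P f 0 = 0" using pointwise_op_right(1)[of f 0 0] by simp
  then show ?thesis using True by (simp add: W.norm_zero V.norm_zero)
next
  case False
  then have pos: "NV v > 0" using v V.norm_nonneg V.norm_eq_0_iff by (metis less_eq_real_def)
  let ?w = "pointwise s2 (of_real (1 / NV v)) v"
  have w: "?w \<in> V" "NV ?w = 1"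
    using V.norm_scale_of_real[OF v, of "1 / NV v"] v pos by (simp_all add: V.scale_mem)
  have "NW (pointwise_op P f ?w) = 1 / NV v * NW (pointwise_op P f v)"
    using W.norm_scale_of_real[of "pointwise_op P f v" "1 / NV v"] f v pos
    by (simp add: pointwise_op_right pointwise_op_mem del: of_real_divide)
  then have "1 / NV v * NW (pointwise_op P f v) \<le> NM f"
    using le_multiplier_norm[OF f w(1)] w(2) by simp
  then show ?thesis using pos by (simp add: field_simps)
qed

text \<open>The zero vector lies in the unit ball of \<open>V\<close>, so the supremum dominates one
  nonnegative number.\<close>

lemma multiplier_norm_nonneg: "f \<in> M \<Longrightarrow> 0 \<le> NM f"
  using le_multiplier_norm[of f 0] W.norm_nonneg[of "pointwise_op P f 0"]
  by (simp add: V.zero_mem V.norm_zero pointwise_op_mem)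

section \<open>The multipliers as a normed space with bounded evaluations\<close>

lemma subspace_multipliers: "module.subspace (pointwise s1) M"
proof -
  interpret F: vector_space "pointwise s1 :: 'k \<Rightarrow> ('d \<Rightarrow> 'x1) \<Rightarrow> 'd \<Rightarrow> 'x1"
    by (rule vector_space_pointwise[OF X1.vector_space_axioms])
  show ?thesis
    by (rule F.subspaceI)
      (auto simp: multipliers_def pointwise_op_left W.zero_mem W.add_mem W.scale_mem)
qed

text \<open>This is where nonvanishing is used. The vector \<open>v\<close> may depend on
  \<open>f\<close>, but \<open>c\<close> does not; bounded evaluation on \<open>W\<close> and the
  operator norm then control \<open>P (f a) (v a)\<close> uniformly.\<close>

lemma evaluation_le_multiplier_norm:
  obtains C where "\<And>f. f \<in> M \<Longrightarrow> norm (f a) \<le> C * NM f"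
proof -
  obtain c where c: "c > 0"
    and ex: "\<And>f. f \<in> M \<Longrightarrow> \<exists>v\<in>V. NV v \<le> 1 \<and> norm (f a) \<le> c * norm (P (f a) (v a))"
    using nonvanishing unfolding nowhere_vanishing_def by blast
  obtain C where C: "C \<ge> 0" "\<And>w. w \<in> W \<Longrightarrow> norm (w a) \<le> C * NW w"
    using W.evaluation_bounded X3.norm_scale by (metis UNIV_I)
  have "norm (f a) \<le> c * C * NM f" if f: "f \<in> M" for f
  proof -
    obtain v where v: "v \<in> V" "NV v \<le> 1" "norm (f a) \<le> c * norm (P (f a) (v a))"
      using ex[OF f] by blast
    have "norm (P (f a) (v a)) \<le> C * NW (pointwise_op P f v)"
      using C(2)[OF pointwise_op_mem[OF f v(1)]] by (simp add: pointwise_op_def)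
    also have "\<dots> \<le> C * NM f"
      by (intro mult_left_mono le_multiplier_norm f v C)
    finally have "c * norm (P (f a) (v a)) \<le> c * (C * NM f)"
      using c by (intro mult_left_mono) auto
    then show ?thesis using v by simp
  qed
  then show thesis by (rule that)
qed

lemma multiplier_norm_scale_le:
  assumes "f \<in> M"
  shows "NM (pointwise s1 c f) \<le> norm c * NM f"
  using assms
  by (intro multiplier_norm_le)
    (simp add: pointwise_op_left W.norm_scale pointwise_op_mem le_multiplier_norm mult_left_mono)

sublocale multipliers: normed_subspace "pointwise s1" M NM
proof -
  interpret F: vector_space "pointwise s1 :: 'k \<Rightarrow> ('d \<Rightarrow> 'x1) \<Rightarrow> 'd \<Rightarrow> 'x1"
    by (rule vector_space_pointwise[OF X1.vector_space_axioms])
  show "normed_subspace (pointwise s1) M NM"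
  proof
    show "F.subspace M" by (rule subspace_multipliers)
    show "0 \<le> NM f" if "f \<in> M" for f using that by (rule multiplier_norm_nonneg)
    show "NM f = 0 \<longleftrightarrow> f = 0" if f: "f \<in> M" for f
    proof
      assume 0: "NM f = 0"
      have "f a = 0" for a
      proof -
        obtain C where "norm (f a) \<le> C * NM f"
          using evaluation_le_multiplier_norm f by metis
        then show ?thesis using 0 by simp
      qed
      then show "f = 0" by auto
    next
      assume "f = 0"
      then have "NM f \<le> 0"
        by (intro multiplier_norm_le) (simp add: pointwise_op_left W.norm_zero)
      then show "NM f = 0" using multiplier_norm_nonneg[OF f] by simp
    qed
    show "NM (pointwise s1 c f) = norm c * NM f" if f: "f \<in> M" for c f
    proof (rule antisym)
      show "NM (pointwise s1 c f) \<le> norm c * NM f" by (rule multiplier_norm_scale_le[OF f])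
      show "norm c * NM f \<le> NM (pointwise s1 c f)"
      proof (cases "c = 0")
        case True
        then show ?thesis
          using multiplier_norm_nonneg[OF F.subspace_scale[OF subspace_multipliers f], of c]
          by simp
      next
        case False
        \<comment> \<open>The reverse inequality is the one already proved, applied to the inverse
          scalar.\<close>
        have "NM f = NM (pointwise s1 (inverse c) (pointwise s1 c f))" using False by simp
        also have "\<dots> \<le> norm (inverse c) * NM (pointwise s1 c f)"
          by (rule multiplier_norm_scale_le[OF F.subspace_scale[OF subspace_multipliers f]])
        finally show ?thesis using False by (simp add: norm_divide field_simps)
      qed
    qed
    show "NM (f + g) \<le> NM f + NM g" if f: "f \<in> M" and g: "g \<in> M" for f g
    proof (rule multiplier_norm_le)
      fix v assume v: "v \<in> V" "NV v \<le> 1"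
      have "NW (pointwise_op P (f + g) v) \<le> NW (pointwise_op P f v) + NW (pointwise_op P g v)"
        unfolding pointwise_op_left by (intro W.norm_triangle pointwise_op_mem f g v)
      also have "\<dots> \<le> NM f + NM g"
        by (intro add_mono le_multiplier_norm f g v)
      finally show "NW (pointwise_op P (f + g) v) \<le> NM f + NM g" .
    qed
  qed
qed

section \<open>Completeness in the operator norm\<close>

lemma mcomplete_multipliers: "multipliers.metric.mcomplete"
  unfolding multipliers.metric.mcomplete_def
proof (intro allI impI)
  fix F :: "nat \<Rightarrow> 'd \<Rightarrow> 'x1" assume "multipliers.metric.MCauchy F"
  then have F: "F n \<in> M"
    and Cauchy: "\<And>e. e > 0 \<Longrightarrow> \<exists>K. \<forall>n n'. K \<le> n \<longrightarrow> K \<le> n' \<longrightarrow> NM (F n - F n') < e" for n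
    unfolding multipliers.MCauchy_iff by auto
  have "\<exists>l. (\<lambda>n. F n a) \<longlonglongrightarrow> l" for a
  proof -
    obtain C where C: "\<And>f. f \<in> M \<Longrightarrow> norm (f a) \<le> C * NM f"
      using evaluation_le_multiplier_norm[of a] by blast
    have "Cauchy (\<lambda>n. F n a)"
    proof (rule CauchyI)
      fix e :: real assume "e > 0"
      then obtain K where K: "\<And>n n'. K \<le> n \<Longrightarrow> K \<le> n' \<Longrightarrow> NM (F n - F n') < e / (\<bar>C\<bar> + 1)"
        using Cauchy[of "e / (\<bar>C\<bar> + 1)"] by (auto simp: field_simps)
      have "norm (F m a - F n a) < e" if "K \<le> m" "K \<le> n" for m n
      proof -
        have D: "F m - F n \<in> M" by (intro multipliers.diff_mem F)
        have "norm (F m a - F n a) \<le> C * NM (F m - F n)" using C[OF D] by simp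
        also have "\<dots> \<le> (\<bar>C\<bar> + 1) * NM (F m - F n)"
          by (intro mult_right_mono multiplier_norm_nonneg D) simp
        also have "\<dots> < (\<bar>C\<bar> + 1) * (e / (\<bar>C\<bar> + 1))"
          by (intro mult_strict_left_mono K that) simp
        finally show ?thesis by simp
      qed
      then show "\<exists>K. \<forall>m\<ge>K. \<forall>n\<ge>K. norm (F m a - F n a) < e" by blast
    qed
    then show ?thesis using Cauchy_convergent convergent_def by blast
  qed
  then obtain f where f: "\<And>a. (\<lambda>n. F n a) \<longlonglongrightarrow> f a" by metis
  \<comment> \<open>This is needed for every \<open>v\<close> in \<open>V\<close>, not only in the
    unit ball, since it is what makes \<open>f\<close> a multiplier.\<close>
  have lim: "limitin W.metric.mtopology (\<lambda>n. pointwise_op P (F n) v) (pointwise_op P f v) sequentially"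
    if v: "v \<in> V" for v
  proof -
    have "W.metric.MCauchy (\<lambda>n. pointwise_op P (F n) v)"
      unfolding W.MCauchy_iff
    proof (intro conjI allI impI)
      show "range (\<lambda>n. pointwise_op P (F n) v) \<subseteq> W" using F v pointwise_op_mem by auto
      fix e :: real assume "e > 0"
      have nv: "NV v \<ge> 0" using v by (rule V.norm_nonneg)
      \<comment> \<open>Adding 1 keeps the divisor positive when \<open>v\<close> is 0.\<close>
      then obtain K where K: "\<And>n n'. K \<le> n \<Longrightarrow> K \<le> n' \<Longrightarrow> NM (F n - F n') < e / (NV v + 1)"
        using Cauchy[of "e / (NV v + 1)"] \<open>e > 0\<close> by (auto simp: field_simps)
      have "NW (pointwise_op P (F n) v - pointwise_op P (F n') v) < e"
        if "K \<le> n" "K \<le> n'" for n n'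
      proof -
        have D: "F n - F n' \<in> M" by (intro multipliers.diff_mem F)
        have "NW (pointwise_op P (F n) v - pointwise_op P (F n') v) \<le> NM (F n - F n') * NV v"
          using le_multiplier_norm_mult[OF D v] by (simp add: pointwise_op_left)
        also have "\<dots> \<le> NM (F n - F n') * (NV v + 1)"
          by (intro mult_left_mono multiplier_norm_nonneg D) simp
        also have "\<dots> < e / (NV v + 1) * (NV v + 1)"
          using nv by (intro mult_strict_right_mono K that) simp
        finally show ?thesis using nv by simp
      qed
      then show "\<exists>K. \<forall>n n'. K \<le> n \<longrightarrow> K \<le> n' \<longrightarrow>
          NW (pointwise_op P (F n) v - pointwise_op P (F n') v) < e" by blast
    qed
    then obtain w where w: "limitin W.metric.mtopology (\<lambda>n. pointwise_op P (F n) v) w sequentially"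
      using W.complete by (auto simp: W.metric.mcomplete_def)
    have "w a = pointwise_op P f v a" for a
    proof (rule LIMSEQ_unique)
      show "(\<lambda>n. pointwise_op P (F n) v a) \<longlonglongrightarrow> w a" by (rule W.tendsto_evaluation[OF w])
      show "(\<lambda>n. pointwise_op P (F n) v a) \<longlonglongrightarrow> pointwise_op P f v a"
        unfolding pointwise_op_def by (rule tendsto_P_left[OF f])
    qed
    then have "w = pointwise_op P f v" by auto
    then show ?thesis using w by simp
  qed
  have fM: "f \<in> M"
    using W.metric.limitin_mspace[OF lim] by (auto simp: multipliers_def)
  have "(\<lambda>n. NM (F n - f)) \<longlonglongrightarrow> 0"
  proof (rule LIMSEQ_I)
    fix e :: real assume "e > 0"
    \<comment> \<open>Letting the second index tend to infinity preserves only a weak inequality;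
      e/2 leaves room for the strict one.\<close>
    then obtain K where K: "\<And>n n'. K \<le> n \<Longrightarrow> K \<le> n' \<Longrightarrow> NM (F n - F n') < e / 2"
      using Cauchy[of "e / 2"] by auto
    have "NM (F n - f) \<le> e / 2" if n: "K \<le> n" for n
    proof (rule multiplier_norm_le)
      fix v assume v: "v \<in> V" "NV v \<le> 1"
      \<comment> \<open>With \<open>n\<close> fixed, these products tend in \<open>W\<close> to the
        product of \<open>F n - f\<close> and \<open>v\<close>, so their norm bound passes to the
        limit.\<close>
      let ?x = "\<lambda>n'. pointwise_op P (F n - F n') v"
      have D: "F n - F n' \<in> M" for n' by (intro multipliers.diff_mem F)
      have fn: "F n - f \<in> M" by (intro multipliers.diff_mem F fM)
      have x: "?x n' \<in> W" for n' by (intro pointwise_op_mem D v)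
      have "(\<lambda>n'. NW (?x n' - pointwise_op P (F n - f) v)) \<longlonglongrightarrow> 0"
      proof -
        \<comment> \<open>The fixed term \<open>F n\<close> cancels, which reduces the claim to
          \<open>lim\<close>.\<close>
        have "?x n' - pointwise_op P (F n - f) v = pointwise_op P f v - pointwise_op P (F n') v" for n'
          by (simp add: pointwise_op_left)
        moreover have "NW (pointwise_op P f v - pointwise_op P (F n') v)
            = NW (pointwise_op P (F n') v - pointwise_op P f v)" for n'
          by (intro W.norm_minus_commute pointwise_op_mem fM F v)
        moreover have "(\<lambda>n'. NW (pointwise_op P (F n') v - pointwise_op P f v)) \<longlonglongrightarrow> 0"
          using lim[OF v(1)] F v pointwise_op_mem by (simp add: W.limitin_iff)
        ultimately show ?thesis by simp
      qed
      then have "limitin W.metric.mtopology ?x (pointwise_op P (F n - f) v) sequentially"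
        using x pointwise_op_mem[OF fn v(1)] by (simp add: W.limitin_iff)
      moreover have "NW (?x n') \<le> e / 2" if "K \<le> n'" for n'
        using le_multiplier_norm[OF D v, of n'] K[OF n that] by simp
      then have "\<forall>\<^sub>F n' in sequentially. NW (?x n') \<le> e / 2"
        by (auto simp: eventually_sequentially)
      ultimately show "NW (pointwise_op P (F n - f) v) \<le> e / 2"
        using W.norm_limit_le[of ?x] x by blast
    qed
    moreover have "NM (F n - f) \<ge> 0" for n
      by (intro multiplier_norm_nonneg multipliers.diff_mem F fM)
    ultimately show "\<exists>K. \<forall>n\<ge>K. norm (NM (F n - f) - 0) < e"
      using \<open>e > 0\<close> by (intro exI[of _ K]) force
  qed
  then show "\<exists>f. limitin multipliers.metric.mtopology F f sequentially"
    using F fM by (auto simp: multipliers.limitin_iff)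
qed

section \<open>Continuity of evaluations and the final theorem\<close>

lemma BK_space_multipliers: "BK_space s1 M NM"
proof
  show "continuous_map multipliers.metric.mtopology euclidean (\<lambda>f. f a)" for a
  proof -
    obtain C where "\<And>f. f \<in> M \<Longrightarrow> norm (f a) \<le> C * NM f"
      using evaluation_le_multiplier_norm[of a] by blast
    then show ?thesis by (intro multipliers.continuous_map_of_bound) auto
  qed
qed (rule mcomplete_multipliers)

end

theorem theorem4p1:
  fixes s1 :: "'k::real_normed_field \<Rightarrow> 'x1::banach \<Rightarrow> 'x1"
    and s2 :: "'k \<Rightarrow> 'x2::banach \<Rightarrow> 'x2"
    and s3 :: "'k \<Rightarrow> 'x3::banach \<Rightarrow> 'x3"
    and P :: "'x1 \<Rightarrow> 'x2 \<Rightarrow> 'x3"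
    and V :: "('d \<Rightarrow> 'x2) set" and NV :: "('d \<Rightarrow> 'x2) \<Rightarrow> real"
    and W :: "('d \<Rightarrow> 'x3) set" and NW :: "('d \<Rightarrow> 'x3) \<Rightarrow> real"
  assumes "Banach_space s1" and "Banach_space s2" and "Banach_space s3"
    and "bounded_bilinear_over s1 s2 s3 P"
    and "BK_space s2 V NV" and "BK_space s3 W NW"
    and "nowhere_vanishing P V NV W"
  shows "(\<forall>f\<in>multipliers P V W. multiplier_bounded P V NV NW f) \<and>
         BK_space s1 (multipliers P V W) (multiplier_norm P V NV NW)"
proof -
  interpret multiplier_spaces s1 s2 s3 V NV W NW P
    using assms by (intro multiplier_spaces.intro multiplier_spaces_axioms.intro)
  show ?thesis using multiplier_bounded BK_space_multipliers by blast
qed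

end
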